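(* Let $\mathscr{A}\subset\mathscr{X}$ be an acceptance set, $S=(S_0,S_T)$ a traded asset, and take $X\in\mathscr{X}$. (i) The following statements are equivalent: (a) $\rho_{\mathscr{A},S}$ is lower semicontinuous at $X$; (b) $X+\frac{m}{S_0}S_T\notin\overline{\mathscr{A}}$ for any $m\in\mathbb{R}$ with $m<\rho_{\mathscr{A},S}(X)$; (c) $\rho_{\overline{\mathscr{A}},S}(X)=\rho_{\mathscr{A},S}(X)$; (d) $\rho_{\mathscr{A},S}$ is norm-continuous from above at $X$; (e) $\rho_{\mathscr{A},S}\left(X+\frac1n 1_\Omega\right)\to\rho_{\mathscr{A},S}(X)$ as $n\to\infty$. (ii) The following statements are equivalent: (a) $\rho_{\mathscr{A},S}$ is upper semicontinuous at $X$; (b) $X+\frac{m}{S_0}S_T\in\operatorname{int}(\mathscr{A})$ for any $m\in\mathbb{R}$ with $m>\rho_{\mathscr{A},S}(X)$; (c) $\rho_{\operatorname{int}(\mathscr{A}),S}(X)=\rho_{\mathscr{A},S}(X)$; (d) $\rho_{\mathscr{A},S}$ is norm-continuous from below at $X$; (e) $\rho_{\mathscr{A},S}\left(X-\frac1n 1_\Omega\right)\to\rho_{\mathscr{A},S}(X)$ as $n\to\infty$.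
   Context: Let $(\Omega,\mathcal{F})$ be a measurable space and $\mathscr{X}$ the Banach space of bounded $\mathcal{F}$-measurable functions $X:\Omega\to\mathbb{R}$ with the supremum norm, ordered pointwise; $\mathscr{X}_+=\{X\in\mathscr{X}: X\ge 0\}$; $1_\Omega$ is the constant function $1$. Functions are not identified almost surely. Interior $\operatorname{int}$, closure $\overline{\,\cdot\,}$ and neighborhoods are with respect to the norm. An acceptance set is a nonempty proper subset $\mathscr{A}\subset\mathscr{X}$ such that $X\in\mathscr{A}$ and $Y\ge X$ imply $Y\in\mathscr{A}$. A traded asset is a pair $S=(S_0,S_T)$ with $S_0\in\mathbb{R}$, $S_0>0$, and $S_T\in\mathscr{X}_+$, $S_T\ne 0$. For any $\mathscr{B}\subset\mathscr{X}$, $\rho_{\mathscr{B},S}:\mathscr{X}\to\overline{\mathbb{R}}=\mathbb{R}\cup\{-\infty,\infty\}$ is $\rho_{\mathscr{B},S}(X)=\inf\{m\in\mathbb{R}: X+\frac{m}{S_0}S_T\in\mathscr{B}\}$ (with $\inf\emptyset=\infty$). A map $\rho:\mathscr{X}\to\overline{\mathbb{R}}$ is lower semicontinuous at $X$ if for every real $c<\rho(X)$ there is a neighborhood $\mathscr{U}$ of $X$ with $\rho(Y)>c$ for all $Y\in\mathscr{U}$; it is upper semicontinuous at $X$ if $-\rho$ is lower semicontinuous at $X$. The map $\rho$ is norm-continuous from above at $X$ if $\rho(X_n)\to\rho(X)$ for every sequence $(X_n)$ in $\mathscr{X}$ with $X_n\ge X_{n+1}$ for all $n$ and $\|X_n-X\|\to0$;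 it is norm-continuous from below at $X$ if $\rho(X_n)\to\rho(X)$ for every sequence $(X_n)$ in $\mathscr{X}$ with $X_n\le X_{n+1}$ for all $n$ and $\|X_n-X\|\to0$. Convergence of values is in $\overline{\mathbb{R}}$. *)

theory Defs
  imports "HOL-Analysis.Analysis"
begin

text \<open>
  The sample space is \<open>space M\<close> with sigma-algebra \<open>sets M\<close>; the measure carried by \<open>M\<close> plays no
  role. Functions on \<open>space M\<close> are represented by their extension with value \<open>undefined\<close> outside
  \<open>space M\<close>, so that HOL equality is pointwise equality on \<open>space M\<close>; algebraic operations
  are therefore written as restricted abstractions \<open>\<lambda>\<omega>\<in>space M. \<dots>\<close>.
\<close>

definition bmfun :: "'a measure \<Rightarrow> ('a \<Rightarrow> real) set" where
  "bmfun M = {X \<in> borel_measurable M. X \<in> extensional (space M) \<and> bounded (X ` space M)}"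

text \<open>The value 0 off \<open>bmfun M\<close> only serves to make \<open>sup_dist\<close> total and nonnegative, as the
  locale \<open>Metric_space\<close> requires.\<close>

definition sup_norm :: "'a measure \<Rightarrow> ('a \<Rightarrow> real) \<Rightarrow> real" where
  "sup_norm M X = (if X \<in> bmfun M \<and> space M \<noteq> {} then SUP \<omega>\<in>space M. \<bar>X \<omega>\<bar> else 0)"

definition sup_dist :: "'a measure \<Rightarrow> ('a \<Rightarrow> real) \<Rightarrow> ('a \<Rightarrow> real) \<Rightarrow> real" where
  "sup_dist M X Y = sup_norm M (\<lambda>\<omega>\<in>space M. X \<omega> - Y \<omega>)"

lemma bmfun_diff:
  assumes "X \<in> bmfun M" "Y \<in> bmfun M"
  shows "(\<lambda>\<omega>\<in>space M. X \<omega> - Y \<omega>) \<in> bmfun M"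
proof -
  have [measurable]: "X \<in> borel_measurable M" "Y \<in> borel_measurable M"
    using assms by (auto simp: bmfun_def)
  have "bounded ((\<lambda>\<omega>. X \<omega> - Y \<omega>) ` space M)"
    using assms by (intro bounded_minus_comp) (auto simp: bmfun_def)
  moreover have "(\<lambda>\<omega>\<in>space M. X \<omega> - Y \<omega>) \<in> borel_measurable M"
    by (subst measurable_cong[where g = "\<lambda>\<omega>. X \<omega> - Y \<omega>"]) auto
  ultimately show ?thesis by (simp add: bmfun_def)
qed

lemma bdd_above_abs: "X \<in> bmfun M \<Longrightarrow> bdd_above ((\<lambda>\<omega>. \<bar>X \<omega>\<bar>) ` space M)"
  by (auto simp: bmfun_def bounded_iff bdd_above_def)

lemma abs_le_sup_norm: "X \<in> bmfun M \<Longrightarrow> \<omega> \<in> space M \<Longrightarrow> \<bar>X \<omega>\<bar> \<le> sup_norm M X"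
  using cSUP_upper[OF _ bdd_above_abs, of \<omega> M X] by (auto simp: sup_norm_def)

lemma sup_norm_nonneg: "0 \<le> sup_norm M X"
proof (cases "X \<in> bmfun M \<and> space M \<noteq> {}")
  case True
  then obtain \<omega> where "\<omega> \<in> space M" by blast
  with True abs_le_sup_norm[of X M \<omega>] show ?thesis by linarith
next
  case False
  then show ?thesis unfolding sup_norm_def by (simp only: if_False)
qed

lemma sup_norm_le:
  assumes "0 \<le> c" "\<And>\<omega>. \<omega> \<in> space M \<Longrightarrow> \<bar>X \<omega>\<bar> \<le> c"
  shows "sup_norm M X \<le> c"
  using assms by (auto simp: sup_norm_def intro: cSUP_least)

lemma abs_diff_le_sup_dist:
  assumes "X \<in> bmfun M" "Y \<in> bmfun M" "\<omega> \<in> space M"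
  shows "\<bar>X \<omega> - Y \<omega>\<bar> \<le> sup_dist M X Y"
  using abs_le_sup_norm[OF bmfun_diff[OF assms(1,2)] assms(3)] assms(3)
  by (simp add: sup_dist_def)

lemma sup_dist_le:
  assumes "0 \<le> c" "\<And>\<omega>. \<omega> \<in> space M \<Longrightarrow> \<bar>X \<omega> - Y \<omega>\<bar> \<le> c"
  shows "sup_dist M X Y \<le> c"
  unfolding sup_dist_def using assms by (intro sup_norm_le) auto

lemma sup_dist_commute: "sup_dist M X Y = sup_dist M Y X"
proof -
  have *: "(\<lambda>\<omega>\<in>space M. X \<omega> - Y \<omega>) \<in> bmfun M"
    if "(\<lambda>\<omega>\<in>space M. Y \<omega> - X \<omega>) \<in> bmfun M" for X Y :: "'a \<Rightarrow> real"
  proof -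
    have "(\<lambda>\<omega>\<in>space M. 0 :: real) \<in> borel_measurable M"
      by (subst measurable_cong[where g = "\<lambda>\<omega>. 0"]) auto
    moreover have "bounded ((\<lambda>\<omega>\<in>space M. 0 :: real) ` space M)"
      by (rule finite_imp_bounded, rule finite_subset[of _ "{0}"]) auto
    ultimately have "(\<lambda>\<omega>\<in>space M. 0) \<in> bmfun M"
      by (simp add: bmfun_def)
    moreover have "(\<lambda>\<omega>\<in>space M. (\<lambda>\<omega>\<in>space M. 0) \<omega> - (\<lambda>\<omega>\<in>space M. Y \<omega> - X \<omega>) \<omega>)
        = (\<lambda>\<omega>\<in>space M. X \<omega> - Y \<omega>)"
      by (rule restrict_ext) simp
    ultimately show ?thesis
      using bmfun_diff[OF _ that] by metis
  qed
  have "(SUP \<omega>\<in>space M. \<bar>(\<lambda>\<omega>\<in>space M. X \<omega> - Y \<omega>) \<omega>\<bar>)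
      = (SUP \<omega>\<in>space M. \<bar>(\<lambda>\<omega>\<in>space M. Y \<omega> - X \<omega>) \<omega>\<bar>)"
    by (intro SUP_cong) (auto simp: abs_minus_commute)
  with *[of X Y] *[of Y X] show ?thesis
    unfolding sup_dist_def sup_norm_def by argo
qed

lemma Metric_space_bmfun: "Metric_space (bmfun M) (sup_dist M)"
proof
  show "0 \<le> sup_dist M X Y" for X Y
    by (simp add: sup_dist_def sup_norm_nonneg)
  show "sup_dist M X Y = sup_dist M Y X" for X Y
    by (rule sup_dist_commute)
  show "sup_dist M X Y = 0 \<longleftrightarrow> X = Y" if XY: "X \<in> bmfun M" "Y \<in> bmfun M" for X Y
  proof
    assume 0: "sup_dist M X Y = 0"
    have "X \<omega> = Y \<omega>" if "\<omega> \<in> space M" for \<omega>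
      using abs_diff_le_sup_dist[OF XY that] 0 by simp
    then show "X = Y"
      using XY by (auto simp: bmfun_def intro: extensionalityI)
  next
    assume "X = Y"
    then have "sup_dist M X Y \<le> 0" by (intro sup_dist_le) auto
    then show "sup_dist M X Y = 0"
      using sup_norm_nonneg[of M "\<lambda>\<omega>\<in>space M. X \<omega> - Y \<omega>"]
      unfolding sup_dist_def by linarith
  qed
  show "sup_dist M X Z \<le> sup_dist M X Y + sup_dist M Y Z"
    if "X \<in> bmfun M" "Y \<in> bmfun M" "Z \<in> bmfun M" for X Y Z
  proof (rule sup_dist_le)
    show "0 \<le> sup_dist M X Y + sup_dist M Y Z"
      by (simp add: sup_dist_def sup_norm_nonneg)
    show "\<bar>X \<omega> - Z \<omega>\<bar> \<le> sup_dist M X Y + sup_dist M Y Z" if "\<omega> \<in> space M" for \<omega>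
      using abs_diff_le_sup_dist[of X M Y \<omega>] abs_diff_le_sup_dist[of Y M Z \<omega>] that
        \<open>X \<in> bmfun M\<close> \<open>Y \<in> bmfun M\<close> \<open>Z \<in> bmfun M\<close> by linarith
  qed
qed

definition bm_topology :: "'a measure \<Rightarrow> ('a \<Rightarrow> real) topology" where
  "bm_topology M = Metric_space.mtopology (bmfun M) (sup_dist M)"

lemma topspace_bm_topology [simp]: "topspace (bm_topology M) = bmfun M"
  by (simp add: bm_topology_def Metric_space.topspace_mtopology Metric_space_bmfun)

definition acceptance_set :: "'a measure \<Rightarrow> ('a \<Rightarrow> real) set \<Rightarrow> bool" where
  "acceptance_set M A \<longleftrightarrow> A \<noteq> {} \<and> A \<subset> bmfun M \<and>
     (\<forall>X\<in>A. \<forall>Y\<in>bmfun M. (\<forall>\<omega>\<in>space M. X \<omega> \<le> Y \<omega>) \<longrightarrow> Y \<in> A)"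

definition traded_asset :: "'a measure \<Rightarrow> real \<times> ('a \<Rightarrow> real) \<Rightarrow> bool" where
  "traded_asset M S \<longleftrightarrow> fst S > 0 \<and> snd S \<in> bmfun M \<and>
     (\<forall>\<omega>\<in>space M. 0 \<le> snd S \<omega>) \<and> snd S \<noteq> (\<lambda>\<omega>\<in>space M. 0)"

definition add_asset ::
  "'a measure \<Rightarrow> real \<times> ('a \<Rightarrow> real) \<Rightarrow> ('a \<Rightarrow> real) \<Rightarrow> real \<Rightarrow> ('a \<Rightarrow> real)" where
  "add_asset M S X m = (\<lambda>\<omega>\<in>space M. X \<omega> + m / fst S * snd S \<omega>)"

definition risk_measure ::
  "'a measure \<Rightarrow> ('a \<Rightarrow> real) set \<Rightarrow> real \<times> ('a \<Rightarrow> real) \<Rightarrow> ('a \<Rightarrow> real) \<Rightarrow> ereal" where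
  "risk_measure M B S X = Inf (ereal ` {m. add_asset M S X m \<in> B})"

definition lsc_at :: "'a measure \<Rightarrow> (('a \<Rightarrow> real) \<Rightarrow> ereal) \<Rightarrow> ('a \<Rightarrow> real) \<Rightarrow> bool" where
  "lsc_at M \<rho> X \<longleftrightarrow> (\<forall>c::real. ereal c < \<rho> X \<longrightarrow>
     (\<exists>U\<subseteq>bmfun M. X \<in> bm_topology M interior_of U \<and> (\<forall>Y\<in>U. ereal c < \<rho> Y)))"

definition usc_at :: "'a measure \<Rightarrow> (('a \<Rightarrow> real) \<Rightarrow> ereal) \<Rightarrow> ('a \<Rightarrow> real) \<Rightarrow> bool" where
  "usc_at M \<rho> X \<longleftrightarrow> lsc_at M (\<lambda>Y. - \<rho> Y) X"

definition norm_continuous_from_above_at ::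
  "'a measure \<Rightarrow> (('a \<Rightarrow> real) \<Rightarrow> ereal) \<Rightarrow> ('a \<Rightarrow> real) \<Rightarrow> bool" where
  "norm_continuous_from_above_at M \<rho> X \<longleftrightarrow>
     (\<forall>Y :: nat \<Rightarrow> 'a \<Rightarrow> real.
        (\<forall>n. Y n \<in> bmfun M) \<longrightarrow> (\<forall>n. \<forall>\<omega>\<in>space M. Y (Suc n) \<omega> \<le> Y n \<omega>) \<longrightarrow>
        (\<lambda>n. sup_dist M (Y n) X) \<longlonglongrightarrow> 0 \<longrightarrow> (\<lambda>n. \<rho> (Y n)) \<longlonglongrightarrow> \<rho> X)"

definition norm_continuous_from_below_at ::
  "'a measure \<Rightarrow> (('a \<Rightarrow> real) \<Rightarrow> ereal) \<Rightarrow> ('a \<Rightarrow> real) \<Rightarrow> bool" where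
  "norm_continuous_from_below_at M \<rho> X \<longleftrightarrow>
     (\<forall>Y :: nat \<Rightarrow> 'a \<Rightarrow> real.
        (\<forall>n. Y n \<in> bmfun M) \<longrightarrow> (\<forall>n. \<forall>\<omega>\<in>space M. Y n \<omega> \<le> Y (Suc n) \<omega>) \<longrightarrow>
        (\<lambda>n. sup_dist M (Y n) X) \<longlonglongrightarrow> 0 \<longrightarrow> (\<lambda>n. \<rho> (Y n)) \<longlonglongrightarrow> \<rho> X)"

end

theory Submission
  imports Defs
begin

text \<open>
  Monotonicity reduces every topological notion to constant perturbations: an acceptance set \<open>A\<close>
  satisfies \<open>Y \<in> closure A\<close> iff \<open>Y + e \<in> A\<close> for all \<open>e > 0\<close>, and \<open>Y \<in> interior A\<close> iff
  \<open>Y - e \<in> A\<close> for some \<open>e > 0\<close>. Likewise a decreasing functional \<open>\<rho>\<close> is lower semicontinuous at \<open>X\<close>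
  iff every \<open>c < \<rho> X\<close> satisfies \<open>c < \<rho> (X + e)\<close> for some \<open>e > 0\<close>. The upper semicontinuous case is
  the same statement for \<open>- \<rho>\<close>, which is decreasing along \<open>-X\<close>; a sign \<open>s\<close> treats both at once.
\<close>

section \<open>Constant shifts and asset positions as bounded measurable functions\<close>

definition shift :: "'a measure \<Rightarrow> ('a \<Rightarrow> real) \<Rightarrow> real \<Rightarrow> ('a \<Rightarrow> real)" where
  "shift M X e = (\<lambda>\<omega>\<in>space M. X \<omega> + e)"

lemma shift_apply [simp]: "\<omega> \<in> space M \<Longrightarrow> shift M X e \<omega> = X \<omega> + e"
  by (simp add: shift_def)

lemma restrict_bmfun:
  assumes "f \<in> borel_measurable M" "bounded (f ` space M)"
  shows "(\<lambda>\<omega>\<in>space M. f \<omega>) \<in> bmfun M"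
proof -
  have "(\<lambda>\<omega>\<in>space M. f \<omega>) \<in> borel_measurable M"
    by (subst measurable_cong[where g = f]) (use assms in auto)
  with assms show ?thesis by (simp add: bmfun_def)
qed

lemma bmfun_bounded_const_mult:
  assumes "Y \<in> bmfun M"
  shows "bounded ((\<lambda>\<omega>. c * Y \<omega>) ` space M)"
proof -
  have "bounded ((\<lambda>y. c *\<^sub>R y) ` Y ` space M)"
    by (rule bounded_scaling) (use assms in \<open>simp add: bmfun_def\<close>)
  then show ?thesis by (simp add: image_image)
qed

lemma shift_bmfun [simp]:
  assumes "X \<in> bmfun M"
  shows "shift M X e \<in> bmfun M"
proof -
  have [measurable]: "X \<in> borel_measurable M"
    using assms by (simp add: bmfun_def)
  have "bounded ((\<lambda>\<omega>. X \<omega> + e) ` space M)"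
    using assms by (intro bounded_plus_comp) (auto simp: bmfun_def bounded_iff)
  then show ?thesis
    unfolding shift_def by (intro restrict_bmfun) auto
qed

lemma add_asset_bmfun [simp]:
  assumes "X \<in> bmfun M" "traded_asset M S"
  shows "add_asset M S X m \<in> bmfun M"
proof -
  have S: "snd S \<in> bmfun M"
    using assms by (simp add: traded_asset_def)
  have [measurable]: "X \<in> borel_measurable M" "snd S \<in> borel_measurable M"
    using assms S by (auto simp: bmfun_def)
  have "bounded ((\<lambda>\<omega>. X \<omega> + m / fst S * snd S \<omega>) ` space M)"
    using assms by (intro bounded_plus_comp bmfun_bounded_const_mult[OF S]) (simp add: bmfun_def)
  then show ?thesis
    unfolding add_asset_def by (intro restrict_bmfun) auto
qed

text \<open>Moves a constant perturbation from the position \<open>add_asset M S X m\<close> to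
  \<open>X\<close> itself, so that closure and interior conditions on the position become conditions
  on \<rho> at shifted arguments.\<close>

lemma add_asset_shift: "add_asset M S (shift M X e) m = shift M (add_asset M S X m) e"
  by (auto simp: add_asset_def shift_def fun_eq_iff)

lemma add_asset_mono:
  assumes "traded_asset M S" "m \<le> m'" "\<And>\<omega>. \<omega> \<in> space M \<Longrightarrow> X \<omega> \<le> Y \<omega>" "\<omega> \<in> space M"
  shows "add_asset M S X m \<omega> \<le> add_asset M S Y m' \<omega>"
  using assms
  by (auto simp: add_asset_def traded_asset_def intro!: add_mono mult_right_mono divide_right_mono)

lemma sup_dist_shift_le: "sup_dist M X (shift M X e) \<le> \<bar>e\<bar>"
  by (rule sup_dist_le) auto

lemma tendsto_sup_dist_apply:
  assumes "\<And>n. Y n \<in> bmfun M" "X \<in> bmfun M" "(\<lambda>n. sup_dist M (Y n) X) \<longlonglongrightarrow> 0" "\<omega> \<in> space M"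
  shows "(\<lambda>n. Y n \<omega>) \<longlonglongrightarrow> X \<omega>"
proof (rule metric_tendsto_imp_tendsto[OF assms(3)])
  show "\<forall>\<^sub>F n in sequentially. dist (Y n \<omega>) (X \<omega>) \<le> dist (sup_dist M (Y n) X) 0"
    using abs_diff_le_sup_dist[OF assms(1,2,4)]
    by (intro always_eventually allI) (fastforce simp: dist_real_def intro: order_trans)
qed

section \<open>Closure and interior of an acceptance set\<close>

lemma acceptance_setD:
  assumes "acceptance_set M A" "Y \<in> A" "Z \<in> bmfun M" "\<And>\<omega>. \<omega> \<in> space M \<Longrightarrow> Y \<omega> \<le> Z \<omega>"
  shows "Z \<in> A"
  using assms by (auto simp: acceptance_set_def)

text \<open>A member \<open>Z\<close> of \<open>A\<close> closer to \<open>Y\<close> than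
  \<open>e\<close> lies below \<open>Y + e\<close>, so monotonicity puts \<open>Y + e\<close> into
  \<open>A\<close>. Conversely, small shifts of \<open>Y\<close> that belong to \<open>A\<close> are
  themselves the approximating points.\<close>

lemma in_closure_acceptance_set_iff:
  assumes A: "acceptance_set M A" and Y: "Y \<in> bmfun M"
  shows "Y \<in> bm_topology M closure_of A \<longleftrightarrow> (\<forall>e>0. shift M Y e \<in> A)"
proof -
  interpret Metric_space "bmfun M" "sup_dist M" by (rule Metric_space_bmfun)
  have "shift M Y e \<in> A" if cl: "\<forall>r>0. \<exists>Z\<in>A. Z \<in> mball Y r" and "e > 0" for e
  proof -
    obtain Z where Z: "Z \<in> A" "Z \<in> mball Y e" using cl \<open>e > 0\<close> by blast
    then have "sup_dist M Y Z < e" "Z \<in> bmfun M" by auto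
    then have "Z \<omega> \<le> shift M Y e \<omega>" if "\<omega> \<in> space M" for \<omega>
      using abs_diff_le_sup_dist[OF Y _ that, of Z] that by simp
    with Z Y show ?thesis by (intro acceptance_setD[OF A Z(1)]) auto
  qed
  moreover have "\<exists>Z\<in>A. Z \<in> mball Y r" if sh: "\<forall>e>0. shift M Y e \<in> A" and "r > 0" for r
  proof
    show "shift M Y (r/2) \<in> A" using that by simp
    show "shift M Y (r/2) \<in> mball Y r"
      using sup_dist_shift_le[of M Y "r/2"] \<open>r > 0\<close> Y by simp
  qed
  ultimately show ?thesis
    unfolding bm_topology_def metric_closure_of using Y by blast
qed

text \<open>Ball form of the interior, serving both the interior of \<open>A\<close> and the
  neighborhoods in \<open>lsc_at\<close>.\<close>

lemma in_interior_bm_topology_iff: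
  assumes "U \<subseteq> bmfun M"
  shows "Y \<in> bm_topology M interior_of U \<longleftrightarrow>
    Y \<in> bmfun M \<and> (\<exists>r>0. \<forall>Z\<in>bmfun M. sup_dist M Y Z < r \<longrightarrow> Z \<in> U)"
proof -
  interpret Metric_space "bmfun M" "sup_dist M" by (rule Metric_space_bmfun)
  show ?thesis
  proof
    assume L: "Y \<in> bm_topology M interior_of U"
    then have "Y \<in> bmfun M"
      using interior_of_subset[of "bm_topology M" U] assms by blast
    moreover obtain r where "r > 0" "mball Y r \<subseteq> bm_topology M interior_of U"
      using openin_interior_of[of "bm_topology M" U] L
      unfolding bm_topology_def openin_mtopology by blast
    ultimately show "Y \<in> bmfun M \<and> (\<exists>r>0. \<forall>Z\<in>bmfun M. sup_dist M Y Z < r \<longrightarrow> Z \<in> U)"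
      using interior_of_subset[of "bm_topology M" U] by (fastforce simp: subset_iff)
  next
    assume R: "Y \<in> bmfun M \<and> (\<exists>r>0. \<forall>Z\<in>bmfun M. sup_dist M Y Z < r \<longrightarrow> Z \<in> U)"
    then obtain r where "r > 0" "mball Y r \<subseteq> U" by (auto simp: subset_iff)
    moreover have "openin (bm_topology M) (mball Y r)"
      unfolding bm_topology_def by simp
    moreover have "Y \<in> mball Y r" using R \<open>r > 0\<close> by simp
    ultimately show "Y \<in> bm_topology M interior_of U"
      unfolding interior_of_def by blast
  qed
qed

text \<open>\<open>Y - e\<close> lies below the whole open ball of radius \<open>e\<close> around
  \<open>Y\<close>, so its acceptance forces the acceptance of the ball. Conversely, a ball of
  radius \<open>r\<close> contains \<open>Y - r/2\<close>.\<close>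

lemma in_interior_acceptance_set_iff:
  assumes A: "acceptance_set M A" and Y: "Y \<in> bmfun M"
  shows "Y \<in> bm_topology M interior_of A \<longleftrightarrow> (\<exists>e>0. shift M Y (- e) \<in> A)"
proof -
  have AM: "A \<subseteq> bmfun M" using A by (auto simp: acceptance_set_def)
  have "\<exists>e>0. shift M Y (- e) \<in> A"
    if "r > 0" "\<forall>Z\<in>bmfun M. sup_dist M Y Z < r \<longrightarrow> Z \<in> A" for r
    using that sup_dist_shift_le[of M Y "- (r/2)"] Y by (intro exI[of _ "r/2"]) auto
  moreover have "Z \<in> A"
    if e: "shift M Y (- e) \<in> A" and Z: "Z \<in> bmfun M" "sup_dist M Y Z < e" for e Z
  proof (rule acceptance_setD[OF A e Z(1)])
    show "shift M Y (- e) \<omega> \<le> Z \<omega>" if "\<omega> \<in> space M" for \<omega>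
      using abs_diff_le_sup_dist[OF Y Z(1) that] that Z(2) by simp
  qed
  ultimately show ?thesis
    unfolding in_interior_bm_topology_iff[OF AM] using Y by blast
qed

section \<open>Elementary bounds and monotonicity of the risk measure\<close>

lemma risk_measure_le: "add_asset M S X m \<in> B \<Longrightarrow> risk_measure M B S X \<le> ereal m"
  unfolding risk_measure_def by (rule Inf_lower) simp

lemma risk_measure_antimono_set: "B \<subseteq> C \<Longrightarrow> risk_measure M C S X \<le> risk_measure M B S X"
  unfolding risk_measure_def by (rule Inf_superset_mono) blast

lemma risk_measure_less_iff:
  "risk_measure M B S X < c \<longleftrightarrow> (\<exists>m. ereal m < c \<and> add_asset M S X m \<in> B)"
  unfolding risk_measure_def by (auto simp: Inf_less_iff)

text \<open>Some admissible \<open>k\<close> lies below \<open>m\<close>, and since the payoff is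
  nonnegative, raising the amount from \<open>k\<close> to \<open>m\<close> preserves acceptance.
  Thus the admissible amounts form an upper ray, and only its endpoint is left undecided by the
  infimum.\<close>

lemma risk_measure_less_imp_in:
  assumes "acceptance_set M A" "traded_asset M S" "X \<in> bmfun M" "risk_measure M A S X < ereal m"
  shows "add_asset M S X m \<in> A"
proof -
  obtain k where k: "k < m" "add_asset M S X k \<in> A"
    using assms(4) by (auto simp: risk_measure_less_iff)
  then show ?thesis
    using assms by (intro acceptance_setD[OF assms(1) k(2)] add_asset_mono) auto
qed

lemma risk_measure_antimono:
  assumes "acceptance_set M A" "traded_asset M S" "Y \<in> bmfun M" "Z \<in> bmfun M"
    and "\<And>\<omega>. \<omega> \<in> space M \<Longrightarrow> Y \<omega> \<le> Z \<omega>"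
  shows "risk_measure M A S Z \<le> risk_measure M A S Y"
proof -
  have "add_asset M S Z m \<in> A" if "add_asset M S Y m \<in> A" for m
    using assms that by (intro acceptance_setD[OF assms(1) that] add_asset_mono) auto
  then show ?thesis
    unfolding risk_measure_def by (intro Inf_superset_mono image_mono) blast
qed

section \<open>Semicontinuity of a functional that decreases in the order twisted by a sign\<close>

context
  fixes M :: "'a measure" and g :: "('a \<Rightarrow> real) \<Rightarrow> ereal" and s :: real and X :: "'a \<Rightarrow> real"
  assumes s: "\<bar>s\<bar> = 1"
    and antimono: "\<And>Y Z. Y \<in> bmfun M \<Longrightarrow> Z \<in> bmfun M \<Longrightarrow>
      (\<And>\<omega>. \<omega> \<in> space M \<Longrightarrow> s * Y \<omega> \<le> s * Z \<omega>) \<Longrightarrow> g Z \<le> g Y"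
    and X: "X \<in> bmfun M"
begin

lemma sign_cases: "s = 1 \<or> s = - 1"
  using s by linarith

text \<open>In the order twisted by \<open>s\<close>, the point \<open>X + s * e\<close> dominates
  the open ball of radius \<open>e\<close> around \<open>X\<close>, so one value of \<open>g\<close>
  bounds \<open>g\<close> from below on that ball.\<close>

lemma antimono_near:
  assumes "Y \<in> bmfun M" "sup_dist M X Y < e"
  shows "g (shift M X (s * e)) \<le> g Y"
proof (rule antimono)
  show "s * Y \<omega> \<le> s * shift M X (s * e) \<omega>" if "\<omega> \<in> space M" for \<omega>
    using abs_diff_le_sup_dist[OF X assms(1) that] assms(2) that sign_cases by auto
qed (use assms X in auto)

lemma antimono_shift:
  assumes "d \<le> e"
  shows "g (shift M X (s * e)) \<le> g (shift M X (s * d))"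
  using assms sign_cases X by (intro antimono) auto

lemma lsc_at_iff_shift:
  "lsc_at M g X \<longleftrightarrow> (\<forall>c::real. ereal c < g X \<longrightarrow> (\<exists>e>0. ereal c < g (shift M X (s * e))))"
proof -
  have "(\<exists>U\<subseteq>bmfun M. X \<in> bm_topology M interior_of U \<and> (\<forall>Y\<in>U. ereal c < g Y)) \<longleftrightarrow>
      (\<exists>e>0. ereal c < g (shift M X (s * e)))" (is "?L \<longleftrightarrow> ?R") for c
  proof
    assume ?L
    then obtain U r where U: "\<forall>Y\<in>U. ereal c < g Y"
      and r: "r > 0" "\<forall>Z\<in>bmfun M. sup_dist M X Z < r \<longrightarrow> Z \<in> U"
      by (auto simp: in_interior_bm_topology_iff)
    \<comment> \<open>Halving \<open>r\<close> keeps the shifted point strictly inside the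
      ball.\<close>
    have "sup_dist M X (shift M X (s * (r/2))) < r"
      using sup_dist_shift_le[of M X "s * (r/2)"] r(1) s by (simp add: abs_mult)
    then show ?R
      using U r X by (intro exI[of _ "r/2"]) auto
  next
    assume ?R
    then obtain e where e: "e > 0" "ereal c < g (shift M X (s * e))" by blast
    \<comment> \<open>On this ball \<open>antimono_near\<close> bounds \<open>g\<close> below by its
      value at \<open>X + s * e\<close>, which exceeds \<open>c\<close>.\<close>
    let ?U = "{Y \<in> bmfun M. sup_dist M X Y < e}"
    have "X \<in> bm_topology M interior_of ?U"
      using e(1) X by (subst in_interior_bm_topology_iff) auto
    moreover have "\<forall>Y\<in>?U. ereal c < g Y"
      using antimono_near e(2) by (auto intro: less_le_trans)
    ultimately show ?L by (intro exI[of _ ?U]) auto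
  qed
  then show ?thesis by (simp add: lsc_at_def)
qed

text \<open>The twisted sequence decreases to its pointwise limit and so stays above it;
  monotonicity then gives \<open>g (Y n) \<le> g X\<close>. Lower semicontinuity supplies the
  matching eventual lower bounds.\<close>

lemma lsc_at_imp_tendsto:
  assumes lsc: "lsc_at M g X"
    and Y: "\<And>n. Y n \<in> bmfun M" "\<And>n \<omega>. \<omega> \<in> space M \<Longrightarrow> s * Y (Suc n) \<omega> \<le> s * Y n \<omega>"
    and lim: "(\<lambda>n. sup_dist M (Y n) X) \<longlonglongrightarrow> 0"
  shows "(\<lambda>n. g (Y n)) \<longlonglongrightarrow> g X"
proof (rule order_tendstoI)
  have "s * X \<omega> \<le> s * Y n \<omega>" if "\<omega> \<in> space M" for n \<omega>
  proof (rule decseq_ge)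
    show "decseq (\<lambda>n. s * Y n \<omega>)"
      using Y(2) that by (simp add: decseq_Suc_iff)
    show "(\<lambda>n. s * Y n \<omega>) \<longlonglongrightarrow> s * X \<omega>"
      by (intro tendsto_mult_left tendsto_sup_dist_apply[OF Y(1) X lim that])
  qed
  then have "g (Y n) \<le> g X" for n
    using Y(1) X by (intro antimono)
  then show "\<forall>\<^sub>F n in sequentially. g (Y n) < a" if "g X < a" for a
    using that by (intro always_eventually allI) (rule le_less_trans)
  show "\<forall>\<^sub>F n in sequentially. a < g (Y n)" if a: "a < g X" for a
  proof -
    \<comment> \<open>\<open>a\<close> may be infinite, whereas \<open>lsc_at\<close> quantifies
      over real levels; hence the real \<open>c\<close> in between.\<close>
    obtain c where "a < ereal c" "ereal c < g X"
      using ereal_dense2[OF a] by blast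
    then obtain e where e: "e > 0" "a < g (shift M X (s * e))"
      using lsc unfolding lsc_at_iff_shift by (meson less_trans)
    have "\<forall>\<^sub>F n in sequentially. sup_dist M (Y n) X < e"
      using lim e(1) by (rule order_tendstoD)
    then show ?thesis
    proof eventually_elim
      case (elim n)
      then have "g (shift M X (s * e)) \<le> g (Y n)"
        using antimono_near Y(1) by (simp add: sup_dist_commute)
      with e(2) show ?case by (rule less_le_trans)
    qed
  qed
qed

text \<open>By \<open>lsc_at_iff_shift\<close>, a single term of the sequence with value above
  \<open>c\<close> is enough.\<close>

lemma tendsto_shift_imp_lsc_at:
  assumes "(\<lambda>n. g (shift M X (s * (1 / real (Suc n))))) \<longlonglongrightarrow> g X"
  shows "lsc_at M g X"
  unfolding lsc_at_iff_shift
proof (intro allI impI)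
  fix c :: real
  assume "ereal c < g X"
  then have "\<forall>\<^sub>F n in sequentially. ereal c < g (shift M X (s * (1 / real (Suc n))))"
    using assms by (intro order_tendstoD)
  then obtain n where "ereal c < g (shift M X (s * (1 / real (Suc n))))"
    by (auto simp: eventually_sequentially)
  then show "\<exists>e>0. ereal c < g (shift M X (s * e))"
    by (intro exI[of _ "1 / real (Suc n)"]) auto
qed

text \<open>Both equivalences come from one cycle: semicontinuity gives convergence along all
  monotone sequences, in particular along the shifts by \<open>s / (n + 1)\<close>, and this gives
  semicontinuity back.\<close>

lemma lsc_at_iff_sequences:
  "lsc_at M g X \<longleftrightarrow> (\<forall>Y. (\<forall>n. Y n \<in> bmfun M) \<longrightarrow>
     (\<forall>n. \<forall>\<omega>\<in>space M. s * Y (Suc n) \<omega> \<le> s * Y n \<omega>) \<longrightarrow>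
     (\<lambda>n. sup_dist M (Y n) X) \<longlonglongrightarrow> 0 \<longrightarrow> (\<lambda>n. g (Y n)) \<longlonglongrightarrow> g X)" (is "?L \<longleftrightarrow> ?D")
  and lsc_at_iff_tendsto_shift:
  "lsc_at M g X \<longleftrightarrow> (\<lambda>n. g (shift M X (s * (1 / real (Suc n))))) \<longlonglongrightarrow> g X" (is "?L \<longleftrightarrow> ?E")
proof -
  have LD: "?L \<Longrightarrow> ?D" using lsc_at_imp_tendsto by blast
  have EL: "?E \<Longrightarrow> ?L" by (rule tendsto_shift_imp_lsc_at)
  have DE: ?E if D: ?D
  proof -
    \<comment> \<open>With \<open>Suc n\<close> the index from 0 runs through the shifts by
      \<open>s\<close>, \<open>s/2\<close>, \<open>s/3\<close> and so on, without division by
      zero.\<close>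
    let ?Y = "\<lambda>n. shift M X (s * (1 / real (Suc n)))"
    have "(\<lambda>n. sup_dist M (?Y n) X) \<longlonglongrightarrow> 0"
    proof (rule tendsto_sandwich[OF _ _ tendsto_const LIMSEQ_inverse_real_of_nat])
      show "\<forall>\<^sub>F n in sequentially. 0 \<le> sup_dist M (?Y n) X"
        by (simp add: sup_dist_def sup_norm_nonneg)
      have "sup_dist M (?Y n) X \<le> inverse (real (Suc n))" for n
        using sup_dist_shift_le[of M X "s * (1 / real (Suc n))"] s
        by (simp add: sup_dist_commute abs_mult inverse_eq_divide)
      then show "\<forall>\<^sub>F n in sequentially. sup_dist M (?Y n) X \<le> inverse (real (Suc n))"
        by simp
    qed
    moreover have "s * ?Y (Suc n) \<omega> \<le> s * ?Y n \<omega>" if "\<omega> \<in> space M" for n \<omega>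
      using that sign_cases by (auto simp: frac_le)
    ultimately show ?thesis
      using D[rule_format, of ?Y] X by auto
  qed
  show "?L \<longleftrightarrow> ?D" "?L \<longleftrightarrow> ?E" using LD DE EL by blast+
qed

end

section \<open>The risk measure of an acceptance set at a fixed position\<close>

context
  fixes M :: "'a measure" and A :: "('a \<Rightarrow> real) set" and S :: "real \<times> ('a \<Rightarrow> real)"
    and X :: "'a \<Rightarrow> real"
  assumes A: "acceptance_set M A" and S: "traded_asset M S" and X: "X \<in> bmfun M"
begin

abbreviation (input) "\<rho> \<equiv> risk_measure M A S"

text \<open>The factors \<open>1\<close> here and \<open>- 1\<close> in the next lemma reproduce the
  premise \<open>antimono\<close> for the two signs, so that the abstract criteria can be
  instantiated by resolution.\<close>

lemma risk_measure_antimono_pos: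
  "Y \<in> bmfun M \<Longrightarrow> Z \<in> bmfun M \<Longrightarrow> (\<And>\<omega>. \<omega> \<in> space M \<Longrightarrow> 1 * Y \<omega> \<le> 1 * Z \<omega>) \<Longrightarrow> \<rho> Z \<le> \<rho> Y"
  using risk_measure_antimono[OF A S, of Y Z] by simp

lemma risk_measure_antimono_neg:
  "Y \<in> bmfun M \<Longrightarrow> Z \<in> bmfun M \<Longrightarrow> (\<And>\<omega>. \<omega> \<in> space M \<Longrightarrow> - 1 * Y \<omega> \<le> - 1 * Z \<omega>) \<Longrightarrow>
    - \<rho> Z \<le> - \<rho> Y"
  using risk_measure_antimono[OF A S, of Z Y] by simp

text \<open>The criteria are, in order, by constant shifts, by monotone sequences and by shifts of
  size \<open>1 / (n + 1)\<close>. The remaining premise on the absolute value of the sign is left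
  to the simplifier.\<close>

lemmas lsc_at_criteria =
  lsc_at_iff_shift[where s = 1 and g = \<rho>, OF _ risk_measure_antimono_pos X]
  lsc_at_iff_sequences[where s = 1 and g = \<rho>, OF _ risk_measure_antimono_pos X]
  lsc_at_iff_tendsto_shift[where s = 1 and g = \<rho>, OF _ risk_measure_antimono_pos X]

lemmas usc_at_criteria =
  lsc_at_iff_shift[where s = "- 1" and g = "\<lambda>Y. - \<rho> Y", OF _ risk_measure_antimono_neg X]
  lsc_at_iff_sequences[where s = "- 1" and g = "\<lambda>Y. - \<rho> Y", OF _ risk_measure_antimono_neg X]
  lsc_at_iff_tendsto_shift[where s = "- 1" and g = "\<lambda>Y. - \<rho> Y", OF _ risk_measure_antimono_neg X]

text \<open>Lying outside the closure means that \<open>m\<close> fails to be admissible for some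
  \<open>X + e\<close>, which forces \<open>m \<le> \<rho> (X + e)\<close>; conversely, an amount
  strictly below \<open>\<rho> (X + e)\<close> is not admissible there.\<close>

lemma lsc_at_iff_notin_closure:
  "lsc_at M \<rho> X \<longleftrightarrow>
    (\<forall>m::real. ereal m < \<rho> X \<longrightarrow> add_asset M S X m \<notin> bm_topology M closure_of A)" (is "_ \<longleftrightarrow> ?B")
proof -
  have cl: "add_asset M S X m \<notin> bm_topology M closure_of A \<longleftrightarrow>
      (\<exists>e>0. add_asset M S (shift M X e) m \<notin> A)" for m
    using in_closure_acceptance_set_iff[OF A] X S by (simp add: add_asset_shift)
  have "\<exists>e>0. ereal c < \<rho> (shift M X e)" if B: ?B and c: "ereal c < \<rho> X" for c
  proof -
    \<comment> \<open>Inadmissibility of \<open>m\<close> yields only a weak inequality; the gap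
      between \<open>c\<close> and \<open>m\<close> restores strictness.\<close>
    obtain m where m: "ereal c < ereal m" "ereal m < \<rho> X"
      using ereal_dense2[OF c] by blast
    then obtain e where e: "e > 0" "add_asset M S (shift M X e) m \<notin> A"
      using B cl by blast
    then have "ereal m \<le> \<rho> (shift M X e)"
      using risk_measure_less_imp_in[OF A S shift_bmfun[OF X]] not_le by blast
    with e(1) m(1) show ?thesis by (meson less_le_trans)
  qed
  moreover have "\<exists>e>0. add_asset M S (shift M X e) m \<notin> A"
    if "\<exists>e>0. ereal m < \<rho> (shift M X e)" for m
    using that risk_measure_le by (metis leD)
  ultimately show ?thesis
    unfolding lsc_at_criteria(1)[simplified] using cl by blast
qed

text \<open>Interior membership makes \<open>m\<close> admissible for some \<open>X - e\<close>,
  hence bounds \<rho> there by \<open>m\<close>. The converse holds because every amount strictly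
  above \<open>\<rho> (X - e)\<close> is admissible.\<close>

lemma usc_at_iff_in_interior:
  "usc_at M \<rho> X \<longleftrightarrow>
    (\<forall>m::real. ereal m > \<rho> X \<longrightarrow> add_asset M S X m \<in> bm_topology M interior_of A)" (is "_ \<longleftrightarrow> ?B")
proof -
  have int: "add_asset M S X m \<in> bm_topology M interior_of A \<longleftrightarrow>
      (\<exists>e>0. add_asset M S (shift M X (- e)) m \<in> A)" for m
    using in_interior_acceptance_set_iff[OF A] X S by (simp add: add_asset_shift)
  have "usc_at M \<rho> X \<longleftrightarrow> (\<forall>c::real. \<rho> X < ereal c \<longrightarrow> (\<exists>e>0. \<rho> (shift M X (- e)) < ereal c))"
    (is "_ \<longleftrightarrow> ?U")
  proof -
    have neg: "ereal c < - x \<longleftrightarrow> x < ereal (- c)" for c x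
      by (cases x) auto
    have "usc_at M \<rho> X \<longleftrightarrow>
        (\<forall>c::real. \<rho> X < ereal (- c) \<longrightarrow> (\<exists>e>0. \<rho> (shift M X (- e)) < ereal (- c)))"
      unfolding usc_at_def using usc_at_criteria(1) by (simp add: neg)
    \<comment> \<open>Negation permutes the real levels, so \<open>- c\<close> may be renamed to
      \<open>c\<close>.\<close>
    also have "\<dots> \<longleftrightarrow> ?U" by (metis minus_minus)
    finally show ?thesis .
  qed
  moreover have "\<exists>e>0. \<rho> (shift M X (- e)) < ereal c" if B: ?B and c: "\<rho> X < ereal c" for c
  proof -
    obtain m where m: "\<rho> X < ereal m" "ereal m < ereal c"
      using ereal_dense2[OF c] by blast
    then obtain e where e: "e > 0" "add_asset M S (shift M X (- e)) m \<in> A"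
      using B int by blast
    then show ?thesis using m(2) risk_measure_le le_less_trans by blast
  qed
  moreover have "\<exists>e>0. add_asset M S (shift M X (- e)) m \<in> A"
    if "\<exists>e>0. \<rho> (shift M X (- e)) < ereal m" for m
    using that risk_measure_less_imp_in[OF A S shift_bmfun[OF X]] by blast
  ultimately show ?thesis using int by blast
qed

text \<open>Enlarging \<open>A\<close> to its closure can only lower the infimum. It does not drop
  exactly when no amount below \<open>\<rho> X\<close> leads into the closure.\<close>

lemma notin_closure_iff_risk_measure_closure_eq:
  "(\<forall>m::real. ereal m < \<rho> X \<longrightarrow> add_asset M S X m \<notin> bm_topology M closure_of A) \<longleftrightarrow>
    risk_measure M (bm_topology M closure_of A) S X = \<rho> X" (is "?B \<longleftrightarrow> ?C")
proof
  have "A \<subseteq> bm_topology M closure_of A"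
    using A by (intro closure_of_subset) (auto simp: acceptance_set_def)
  then have le: "risk_measure M (bm_topology M closure_of A) S X \<le> \<rho> X"
    by (rule risk_measure_antimono_set)
  show ?C if ?B
  proof (rule antisym[OF le])
    show "\<rho> X \<le> risk_measure M (bm_topology M closure_of A) S X"
      using that unfolding risk_measure_def[of M "_ closure_of _"]
      by (intro Inf_greatest) (use not_le in blast)
  qed
  show ?B if ?C
    using that risk_measure_le by (metis leD)
qed

text \<open>Passing to the interior can only raise the infimum, and a strict gap would contain a
  real amount contradicting the left side. The other direction rests on the interior inheriting the
  monotonicity of \<open>A\<close>.\<close>

lemma in_interior_iff_risk_measure_interior_eq:
  "(\<forall>m::real. ereal m > \<rho> X \<longrightarrow> add_asset M S X m \<in> bm_topology M interior_of A) \<longleftrightarrow>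
    risk_measure M (bm_topology M interior_of A) S X = \<rho> X" (is "?B \<longleftrightarrow> ?C")
proof
  let ?I = "bm_topology M interior_of A"
  have le: "\<rho> X \<le> risk_measure M ?I S X"
    by (rule risk_measure_antimono_set) (rule interior_of_subset)
  show ?C if B: ?B
  proof (rule antisym[OF _ le], rule ccontr)
    assume "\<not> risk_measure M ?I S X \<le> \<rho> X"
    then have "\<rho> X < risk_measure M ?I S X" by simp
    then obtain m where "\<rho> X < ereal m" "ereal m < risk_measure M ?I S X"
      using ereal_dense2 by blast
    with B risk_measure_le[of M S X m ?I] show False by auto
  qed
  show ?B if C: ?C
  proof (intro allI impI)
    fix m :: real
    assume "\<rho> X < ereal m"
    then obtain k where k: "k < m" "add_asset M S X k \<in> ?I"
      unfolding C[symmetric] risk_measure_less_iff by auto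
    then obtain e where e: "e > 0" "shift M (add_asset M S X k) (- e) \<in> A"
      using in_interior_acceptance_set_iff[OF A] X S by auto
    \<comment> \<open>The same \<open>e\<close> serves for \<open>m\<close>, since the position with
      \<open>m > k\<close> dominates the one with \<open>k\<close>.\<close>
    have "shift M (add_asset M S X m) (- e) \<in> A"
    proof (rule acceptance_setD[OF A e(2)])
      show "shift M (add_asset M S X k) (- e) \<omega> \<le> shift M (add_asset M S X m) (- e) \<omega>"
        if "\<omega> \<in> space M" for \<omega>
        using add_asset_mono[OF S, of k m X X \<omega>] that k(1) by simp
    qed (use X S in simp)
    with e(1) show "add_asset M S X m \<in> ?I"
      using in_interior_acceptance_set_iff[OF A] X S by auto
  qed
qed

lemma lsc_at_iff_norm_continuous_from_above:
  "lsc_at M \<rho> X \<longleftrightarrow> norm_continuous_from_above_at M \<rho> X"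
  unfolding norm_continuous_from_above_at_def using lsc_at_criteria(2) by simp

text \<open>The sign \<open>- 1\<close> turns decreasing sequences into increasing ones, and
  convergence of the negated values is equivalent to convergence of the values.\<close>

lemma usc_at_iff_norm_continuous_from_below:
  "usc_at M \<rho> X \<longleftrightarrow> norm_continuous_from_below_at M \<rho> X"
  unfolding norm_continuous_from_below_at_def usc_at_def
  using usc_at_criteria(2) by (simp add: ereal_Lim_uminus[symmetric])

lemma lsc_at_iff_tendsto_add_inverse:
  "lsc_at M \<rho> X \<longleftrightarrow> (\<lambda>n. \<rho> (\<lambda>\<omega>\<in>space M. X \<omega> + 1 / real (Suc n))) \<longlonglongrightarrow> \<rho> X"
  using lsc_at_criteria(3) by (simp add: shift_def)

lemma usc_at_iff_tendsto_diff_inverse: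
  "usc_at M \<rho> X \<longleftrightarrow> (\<lambda>n. \<rho> (\<lambda>\<omega>\<in>space M. X \<omega> - 1 / real (Suc n))) \<longlonglongrightarrow> \<rho> X"
  unfolding usc_at_def using usc_at_criteria(3)
  by (simp add: shift_def ereal_Lim_uminus[symmetric])

end

theorem theorem4p4:
  fixes M :: "'a measure"
    and A :: "('a \<Rightarrow> real) set"
    and S :: "real \<times> ('a \<Rightarrow> real)"
    and X :: "'a \<Rightarrow> real"
  assumes "acceptance_set M A"
    and "traded_asset M S"
    and "X \<in> bmfun M"
  shows
    "((lsc_at M (risk_measure M A S) X
        \<longleftrightarrow> (\<forall>m::real. ereal m < risk_measure M A S X \<longrightarrow>
               add_asset M S X m \<notin> bm_topology M closure_of A))
      \<and> (lsc_at M (risk_measure M A S) X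
        \<longleftrightarrow> risk_measure M (bm_topology M closure_of A) S X = risk_measure M A S X)
      \<and> (lsc_at M (risk_measure M A S) X
        \<longleftrightarrow> norm_continuous_from_above_at M (risk_measure M A S) X)
      \<and> (lsc_at M (risk_measure M A S) X
        \<longleftrightarrow> (\<lambda>n::nat. risk_measure M A S (\<lambda>\<omega>\<in>space M. X \<omega> + 1 / real (Suc n)))
               \<longlonglongrightarrow> risk_measure M A S X))
     \<and>
     ((usc_at M (risk_measure M A S) X
        \<longleftrightarrow> (\<forall>m::real. ereal m > risk_measure M A S X \<longrightarrow>
               add_asset M S X m \<in> bm_topology M interior_of A))
      \<and> (usc_at M (risk_measure M A S) X
        \<longleftrightarrow> risk_measure M (bm_topology M interior_of A) S X = risk_measure M A S X)
      \<and> (usc_at M (risk_measure M A S) X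
        \<longleftrightarrow> norm_continuous_from_below_at M (risk_measure M A S) X)
      \<and> (usc_at M (risk_measure M A S) X
        \<longleftrightarrow> (\<lambda>n::nat. risk_measure M A S (\<lambda>\<omega>\<in>space M. X \<omega> - 1 / real (Suc n)))
               \<longlonglongrightarrow> risk_measure M A S X))"
  \<comment> \<open>The equalities of risk measures are linked to semicontinuity through the closure
    and interior conditions; the other equivalences are direct.\<close>
  using lsc_at_iff_notin_closure[OF assms] notin_closure_iff_risk_measure_closure_eq[OF assms]
    lsc_at_iff_norm_continuous_from_above[OF assms] lsc_at_iff_tendsto_add_inverse[OF assms]
    usc_at_iff_in_interior[OF assms] in_interior_iff_risk_measure_interior_eq[OF assms]
    usc_at_iff_norm_continuous_from_below[OF assms] usc_at_iff_tendsto_diff_inverse[OF assms]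
  by argo

end
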